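(* There exist constants $c>0$ and $\epsilon_0>0$ such that for every $\epsilon\in(0,\epsilon_0)$ there is an instance of the online (unweighted) \textsc{MaximumIndependentSet} problem on which every online algorithm that maintains at every time an independent set of size at least $(1-\epsilon)\,\mathrm{opt}$ has amortized migration factor at least $c/\epsilon$.
   Context: Online \textsc{MaximumIndependentSet} (dynamic, on arbitrary graphs): starting from the empty graph, at each time step one vertex arrives together with its edges to present vertices, or one present vertex departs together with its edges. The algorithm outputs an independent set $S_t$ of the current graph at each time without knowledge of the future, and $\mathrm{opt}$ is the current maximum independent set size. Every vertex has profit $1$. The migration potential of each step is $1$. The migration cost of changing $S_{t-1}$ to $S_t$ is $|S_{t-1}\triangle S_t|$, excluding the initial inclusion of a newly arrived vertex. The amortized migration factor is the maximum over $t$ of (total migration cost up to $t$)/(total migration potential up to $t$). *)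

theory Defs
  imports Complex_Main
begin

text \<open>A simple undirected graph: the set of vertices and the set of its edges, an edge being
  the two-element set of its endpoints.\<close>

type_synonym 'v graph = "'v set \<times> 'v set set"

definition empty_graph :: "'v graph" where
  "empty_graph = ({}, {})"

definition independent_set :: "'v graph \<Rightarrow> 'v set \<Rightarrow> bool" where
  "independent_set G S \<longleftrightarrow> S \<subseteq> fst G \<and> (\<forall>u\<in>S. \<forall>v\<in>S. {u, v} \<notin> snd G)"

text \<open>All graphs to which this is applied have a finite vertex set, so the maximum exists.\<close>

definition opt :: "'v graph \<Rightarrow> nat" where
  "opt G = Max {card S | S. independent_set G S}"

text \<open>\<open>Arrive v N\<close>: the vertex \<open>v\<close> arrives with an edge to each vertex of \<open>N\<close>.\<close>

datatype 'v event = Arrive 'v "'v set" | Depart 'v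

fun admissible :: "'v graph \<Rightarrow> 'v event \<Rightarrow> bool" where
  "admissible (V, E) (Arrive v N) \<longleftrightarrow> v \<notin> V \<and> N \<subseteq> V"
| "admissible (V, E) (Depart v) \<longleftrightarrow> v \<in> V"

fun update :: "'v graph \<Rightarrow> 'v event \<Rightarrow> 'v graph" where
  "update (V, E) (Arrive v N) = (insert v V, E \<union> {{v, u} | u. u \<in> N})"
| "update (V, E) (Depart v) = (V - {v}, {e \<in> E. v \<notin> e})"

definition graph_after :: "'v event list \<Rightarrow> 'v graph" where
  "graph_after h = foldl update empty_graph h"

definition valid_instance :: "'v event list \<Rightarrow> bool" where
  "valid_instance I \<longleftrightarrow> I \<noteq> [] \<and> (\<forall>t<length I. admissible (graph_after (take t I)) (I ! t))"

text \<open>An online algorithm determines its current solution from the history of events so far.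
  On the instance \<open>I\<close>, the solution at time \<open>t\<close> is \<open>solution A I t\<close>; time \<open>0\<close> is before the
  first event, and the event of step \<open>t \<ge> 1\<close> is \<open>I ! (t - 1)\<close>.\<close>

type_synonym 'v algorithm = "'v event list \<Rightarrow> 'v set"

definition solution :: "'v algorithm \<Rightarrow> 'v event list \<Rightarrow> nat \<Rightarrow> 'v set" where
  "solution A I t = A (take t I)"

definition maintains_approximation :: "real \<Rightarrow> 'v algorithm \<Rightarrow> 'v event list \<Rightarrow> bool" where
  "maintains_approximation \<epsilon> A I \<longleftrightarrow>
     (\<forall>t\<le>length I. independent_set (graph_after (take t I)) (solution A I t) \<and>
        real (card (solution A I t)) \<ge> (1 - \<epsilon>) * real (opt (graph_after (take t I))))"

fun newly_arrived :: "'v event \<Rightarrow> 'v set" where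
  "newly_arrived (Arrive v N) = {v}"
| "newly_arrived (Depart v) = {}"

text \<open>A newly arrived vertex is not in the previous solution, so removing it from the symmetric
  difference discounts exactly its initial inclusion. A departing vertex that was in the
  previous solution is counted.\<close>

definition migration_cost :: "'v algorithm \<Rightarrow> 'v event list \<Rightarrow> nat \<Rightarrow> nat" where
  "migration_cost A I t =
     card (sym_diff (solution A I (t - 1)) (solution A I t) - newly_arrived (I ! (t - 1)))"

definition migration_potential :: "'v event list \<Rightarrow> nat \<Rightarrow> nat" where
  "migration_potential I t = 1"

definition amortized_migration_factor :: "'v algorithm \<Rightarrow> 'v event list \<Rightarrow> real" where
  "amortized_migration_factor A I =
     Max ((\<lambda>t. real (\<Sum>s = 1..t. migration_cost A I s) / real (\<Sum>s = 1..t. migration_potential I s))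
           ` {1..length I})"

end

theory Submission
  imports Defs
begin

text \<open>In a complete bipartite graph every independent set lies within one side. Fix one side of
  size \<open>n + 1\<close>, where \<open>n\<close> is about \<open>1 / (2 \<epsilon>)\<close>, and let the size of the other side oscillate
  between \<open>n\<close> and \<open>n + 2\<close>. Since \<open>\<epsilon> (n + 2) < 1\<close>, the solution must be optimal up to less than
  one vertex, so it lies on the larger side at both extremes, and every four steps it gives up
  \<open>n + 1\<close> vertices. After \<open>n\<close> rounds this outweighs the \<open>2 n + 1\<close> steps that build the graph.\<close>

section \<open>Independent sets in complete bipartite graphs\<close>

lemma card_le_opt:
  assumes "finite (fst G)" "independent_set G S"
  shows "card S \<le> opt G"
proof -
  have "{card S | S. independent_set G S} \<subseteq> card ` Pow (fst G)"
    by (auto simp: independent_set_def)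
  then have "finite {card S | S. independent_set G S}"
    using assms(1) by (meson finite_Pow_iff finite_imageI finite_subset)
  then show ?thesis
    unfolding opt_def using assms(2) by (intro Max_ge) auto
qed

text \<open>The fixed side is \<open>{..<l}\<close> and the varying side \<open>{l..<j}\<close>.
  Counting all vertices by \<open>j\<close> lets this one number also describe the stages in which
  the graph is built up.\<close>

definition bipartite :: "nat \<Rightarrow> nat \<Rightarrow> nat graph" where
  "bipartite l j = ({..<j}, {{u, v} | u v. u < l \<and> l \<le> v \<and> v < j})"

definition arrival :: "nat \<Rightarrow> nat \<Rightarrow> nat event" where
  "arrival l j = Arrive j (if j < l then {} else {..<l})"

lemma update_arrival: "update (bipartite l j) (arrival l j) = bipartite l (Suc j)"
proof (cases "j < l")
  case True
  then show ?thesis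
    by (auto simp: bipartite_def arrival_def)
next
  case False
  have "{{u, v} |u v. u < l \<and> l \<le> v \<and> v < j} \<union> {{j, u} |u. u < l}
      = {{u, v} |u v. u < l \<and> l \<le> v \<and> v < Suc j}" (is "?A \<union> ?B = ?C")
  proof
    show "?A \<union> ?B \<subseteq> ?C"
      \<comment> \<open>New edges list the arriving vertex first, while \<open>bipartite\<close>
        lists the endpoint in the fixed side first.\<close>
      using False by (auto simp: less_Suc_eq) (metis insert_commute not_less)
    show "?C \<subseteq> ?A \<union> ?B"
      by (auto simp: less_Suc_eq)
  qed
  with False show ?thesis
    by (auto simp: bipartite_def arrival_def)
qed

lemma update_departure:
  assumes "l \<le> j"
  shows "update (bipartite l (Suc j)) (Depart j) = bipartite l j"
  using assms by (auto simp: bipartite_def less_Suc_eq)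

lemma independent_set_bipartite_iff:
  assumes "l \<le> j"
  shows "independent_set (bipartite l j) S \<longleftrightarrow> S \<subseteq> {..<l} \<or> S \<subseteq> {l..<j}"
proof
  assume S: "independent_set (bipartite l j) S"
  show "S \<subseteq> {..<l} \<or> S \<subseteq> {l..<j}"
  proof (rule ccontr)
    assume "\<not> ?thesis"
    then obtain u v where "u \<in> S" "\<not> u < l" "v \<in> S" "v \<notin> {l..<j}"
      by (meson lessThan_iff subsetI)
    moreover have "S \<subseteq> {..<j}"
      using S by (simp add: independent_set_def bipartite_def)
    ultimately have "v < l" "l \<le> u" "u < j"
      by auto
    then have "{v, u} \<in> snd (bipartite l j)"
      by (auto simp: bipartite_def)
    with S \<open>u \<in> S\<close> \<open>v \<in> S\<close> show False
      by (auto simp: independent_set_def)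
  qed
next
  assume "S \<subseteq> {..<l} \<or> S \<subseteq> {l..<j}"
  with assms show "independent_set (bipartite l j) S"
    by (auto simp: independent_set_def bipartite_def doubleton_eq_iff subset_iff)
qed

text \<open>Each side is independent. Lower bounds suffice, since a larger optimum only demands a
  larger solution.\<close>

lemma opt_bipartite_ge:
  assumes "l \<le> j"
  shows "l \<le> opt (bipartite l j)" "j - l \<le> opt (bipartite l j)"
  using card_le_opt[of "bipartite l j" "{..<l}"] card_le_opt[of "bipartite l j" "{l..<j}"] assms
  by (simp_all add: independent_set_bipartite_iff) (simp_all add: bipartite_def)

text \<open>The loss \<epsilon> k is below one, so c > k - 1, and integrality gives c \<ge> k. Later
  k' is the size of the side that is to be excluded.\<close>

lemma less_card_if_approximation:
  fixes \<epsilon> :: real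
  assumes "(1 - \<epsilon>) * real k \<le> real c" "k' < k" "\<epsilon> * real k < 1"
  shows "k' < c"
proof -
  have "real k - 1 < real c"
    using assms(1,3) by (simp add: algebra_simps)
  with assms(2) show ?thesis
    by linarith
qed

section \<open>The oscillating instance\<close>

text \<open>The number of present vertices at time \<open>t\<close>.\<close>

definition walk :: "nat \<Rightarrow> nat \<Rightarrow> nat" where
  "walk m t = (if t \<le> m then t else m + [0, 1, 2, 1] ! ((t - m) mod 4))"

lemma walk_base: "walk m (m + 4 * k) = m"
  and walk_top: "walk m (m + 4 * k + 2) = m + 2"
proof -
  show "walk m (m + 4 * k) = m"
    by (simp add: walk_def)
  have "(4 * k + 2) mod 4 = 2"
    by presburger
  then show "walk m (m + 4 * k + 2) = m + 2"
    by (simp add: walk_def)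
qed

text \<open>The bound in the second case ensures, for \<open>l \<le> m\<close>, that only vertices
  of the varying side depart.\<close>

lemma walk_step:
  obtains "walk m (Suc t) = Suc (walk m t)"
    | "walk m t = Suc (walk m (Suc t))" "m \<le> walk m (Suc t)"
proof (cases "t < m")
  case True
  then show thesis
    using that by (simp add: walk_def)
next
  case False
  then obtain s where t: "t = m + s"
    using le_Suc_ex not_less by blast
  have walk: "walk m (m + r) = m + [0, 1, 2, 1] ! (r mod 4)" for r
    by (simp add: walk_def)
  consider "s mod 4 = 0" "Suc s mod 4 = 1" | "s mod 4 = 1" "Suc s mod 4 = 2"
    | "s mod 4 = 2" "Suc s mod 4 = 3" | "s mod 4 = 3" "Suc s mod 4 = 0"
    by atomize_elim presburger
  then show thesis
    using that walk[of s] walk[of "Suc s"] unfolding t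
    by cases simp_all
qed

text \<open>Vertices come and go as on a stack: the highest number departs and is reused at the next
  arrival.\<close>

definition walk_event :: "nat \<Rightarrow> nat \<Rightarrow> nat \<Rightarrow> nat event" where
  "walk_event l m t = (if walk m t < walk m (Suc t) then arrival l (walk m t)
     else Depart (walk m (Suc t)))"

definition walk_instance :: "nat \<Rightarrow> nat \<Rightarrow> nat \<Rightarrow> nat event list" where
  "walk_instance l m T = map (walk_event l m) [0..<T]"

lemma walk_instance_simps:
  shows length_walk_instance: "length (walk_instance l m T) = T"
    and nth_walk_instance: "t < T \<Longrightarrow> walk_instance l m T ! t = walk_event l m t"
  by (simp_all add: walk_instance_def)

lemma update_walk_event:
  assumes "l \<le> m"
  shows "update (bipartite l (walk m t)) (walk_event l m t) = bipartite l (walk m (Suc t))"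
  using assms
  by (cases rule: walk_step[of m t])
    (auto simp: walk_event_def update_arrival update_departure)

lemma graph_after_walk_instance:
  assumes "l \<le> m" "t \<le> T"
  shows "graph_after (take t (walk_instance l m T)) = bipartite l (walk m t)"
  using assms(2)
proof (induction t)
  case 0
  then show ?case
    by (simp add: graph_after_def empty_graph_def bipartite_def walk_def)
next
  case (Suc t)
  then show ?case
    using update_walk_event[OF assms(1), of t]
    by (simp add: graph_after_def take_Suc_conv_app_nth walk_instance_simps)
qed

lemma valid_walk_instance:
  assumes "l \<le> m" "0 < T"
  shows "valid_instance (walk_instance l m T)"
proof -
  have "admissible (bipartite l (walk m t)) (walk_event l m t)" for t
    by (cases rule: walk_step[of m t]) (auto simp: walk_event_def arrival_def bipartite_def)
  then show ?thesis
    using assms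
    by (auto simp: valid_instance_def graph_after_walk_instance walk_instance_simps)
      (simp add: walk_instance_def)
qed

section \<open>Lower bound on the migration\<close>

lemma newly_arrived_walk_event: "newly_arrived (walk_event l m t) \<inter> {..<walk m t} = {}"
  by (auto simp: walk_event_def arrival_def)

text \<open>Costs are nonnegative, so it is enough to charge the first two steps of each round,
  those in which the varying side grows.\<close>

lemma sum_blocks_ge:
  fixes f :: "nat \<Rightarrow> nat"
  assumes "\<And>k. k < K \<Longrightarrow> c \<le> f (m + 4 * k + 1) + f (m + 4 * k + 2)"
  shows "K * c \<le> (\<Sum>s = 1..m + 4 * K. f s)"
  using assms
proof (induction K)
  case (Suc K)
  have "(\<Sum>s = 1..m + 4 * Suc K. f s) = (\<Sum>s = 1..m + 4 * K. f s)
      + f (m + 4 * K + 1) + f (m + 4 * K + 2) + f (m + 4 * K + 3) + f (m + 4 * K + 4)"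
    by (simp add: numeral_eq_Suc)
  moreover have "K * c \<le> (\<Sum>s = 1..m + 4 * K. f s)"
    using Suc by simp
  ultimately show ?case
    using Suc.prems[of K] by simp
qed simp

lemma walk_instance_migration:
  fixes \<epsilon> :: real and n K :: nat
  defines "I \<equiv> walk_instance (Suc n) (2 * n + 1) (2 * n + 1 + 4 * K)"
  assumes approx: "maintains_approximation \<epsilon> A I" and eps: "0 < \<epsilon>" "\<epsilon> * real (n + 2) < 1"
  shows "K * (n + 1) \<le> (\<Sum>s = 1..2 * n + 1 + 4 * K. migration_cost A I s)"
proof (rule sum_blocks_ge)
  let ?m = "2 * n + 1" and ?T = "2 * n + 1 + 4 * K"
  define S where "S = solution A I"
  have len: "length I = ?T"
    by (simp add: I_def walk_instance_simps)
  have graph: "graph_after (take t I) = bipartite (Suc n) (walk ?m t)" if "t \<le> ?T" for t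
    unfolding I_def using that by (intro graph_after_walk_instance) auto
  have indep: "independent_set (bipartite (Suc n) (walk ?m t)) (S t)"
    and card_S: "(1 - \<epsilon>) * real (opt (bipartite (Suc n) (walk ?m t))) \<le> real (card (S t))"
    if "t \<le> ?T" for t
    using approx that graph[OF that] by (auto simp: maintains_approximation_def len S_def)
  have subset_S: "S t \<subseteq> {..<walk ?m t}" if "t \<le> ?T" for t
    using indep[OF that] by (simp add: independent_set_def bipartite_def)
  then have fin: "finite (S t)" if "t \<le> ?T" for t
    using that finite_subset by blast
  have "\<epsilon> * 1 \<le> \<epsilon> * real (n + 2)"
    using eps(1) by (intro mult_left_mono) auto
  \<comment> \<open>This makes 1 - \<epsilon> nonnegative, so that \<open>opt\<close> may be
    replaced by a lower bound \<open>k\<close>.\<close>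
  then have eps1: "\<epsilon> < 1"
    using eps(2) by linarith
  have card_gt: "k' < card (S t)"
    if "t \<le> ?T" "k \<le> opt (bipartite (Suc n) (walk ?m t))" "k' < k" "k \<le> n + 2" for t k k'
  proof (rule less_card_if_approximation)
    have "(1 - \<epsilon>) * real k \<le> (1 - \<epsilon>) * real (opt (bipartite (Suc n) (walk ?m t)))"
      using eps1 that(2) by (intro mult_left_mono) auto
    also have "\<dots> \<le> real (card (S t))"
      by (rule card_S[OF that(1)])
    finally show "(1 - \<epsilon>) * real k \<le> real (card (S t))" .
    have "\<epsilon> * real k \<le> \<epsilon> * real (n + 2)"
      using eps(1) that(4) by (intro mult_left_mono) auto
    then show "\<epsilon> * real k < 1"
      using eps(2) by linarith
  qed (fact that)
  have cost: "card (S t - S (Suc t)) \<le> migration_cost A I (Suc t)" if "Suc t \<le> ?T" for t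
  proof -
    \<comment> \<open>An arriving vertex was not in the previous solution, so the discount never
      hides a removal.\<close>
    have "newly_arrived (I ! t) \<inter> S t = {}"
      using newly_arrived_walk_event[of "Suc n" ?m t] subset_S[of t] that
      by (auto simp: I_def nth_walk_instance)
    then have "S t - S (Suc t) \<subseteq> sym_diff (S t) (S (Suc t)) - newly_arrived (I ! t)"
      by auto
    then show ?thesis
      unfolding migration_cost_def using fin[of t] fin[of "Suc t"] that
      by (auto simp: S_def intro!: card_mono)
  qed
  fix k
  assume "k < K"
  then have le: "?m + 4 * k + 2 \<le> ?T"
    by simp
  \<comment> \<open>The varying side has only n vertices, too few; more than n vertices of the fixed
    side means all n + 1 of them.\<close>
  have base: "S (?m + 4 * k) = {..<Suc n}"
  proof -
    let ?t = "?m + 4 * k"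
    have walk: "walk ?m ?t = ?m"
      by (rule walk_base)
    have "n < card (S ?t)"
      using card_gt[of ?t "n + 1" n] le opt_bipartite_ge(1)[of "Suc n" ?m] walk by simp
    moreover have "card (S ?t) \<le> n" if "S ?t \<subseteq> {Suc n..<?m}"
      using card_mono[OF _ that] by simp
    ultimately have "S ?t \<subseteq> {..<Suc n}"
      using indep[of ?t] le walk independent_set_bipartite_iff[of "Suc n" ?m] by force
    with \<open>n < card (S ?t)\<close> show ?thesis
      by (intro card_subset_eq) (auto dest: card_mono[rotated])
  qed
  \<comment> \<open>Now the varying side has n + 2 vertices, and the n + 1 of the fixed side are too
    few.\<close>
  have top: "S (?m + 4 * k + 2) \<inter> {..<Suc n} = {}"
  proof -
    let ?t = "?m + 4 * k + 2"
    have walk: "walk ?m ?t = ?m + 2"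
      by (rule walk_top)
    have "n + 1 < card (S ?t)"
      using card_gt[of ?t "n + 2" "n + 1"] le opt_bipartite_ge(2)[of "Suc n" "?m + 2"] walk
      by simp
    moreover have "card (S ?t) \<le> n + 1" if "S ?t \<subseteq> {..<Suc n}"
      using card_mono[OF _ that] by simp
    ultimately have "S ?t \<subseteq> {Suc n..<?m + 2}"
      using indep[of ?t] le walk independent_set_bipartite_iff[of "Suc n" "?m + 2"] by force
    then show ?thesis
      by auto
  qed
  let ?t = "?m + 4 * k"
  have "n + 1 = card (S ?t - S (?t + 2))"
    using base top by (simp add: Diff_triv Int_commute)
  \<comment> \<open>A vertex lost over two steps is lost in one of them.\<close>
  also have "\<dots> \<le> card ((S ?t - S (Suc ?t)) \<union> (S (Suc ?t) - S (?t + 2)))"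
    using fin le by (intro card_mono) auto
  also have "\<dots> \<le> card (S ?t - S (Suc ?t)) + card (S (Suc ?t) - S (?t + 2))"
    by (rule card_Un_le)
  also have "\<dots> \<le> migration_cost A I (?t + 1) + migration_cost A I (?t + 2)"
    using cost[of ?t] cost[of "Suc ?t"] le by simp
  finally show "n + 1 \<le> migration_cost A I (?t + 1) + migration_cost A I (?t + 2)" .
qed

lemma amortized_migration_factor_ge:
  assumes "I \<noteq> []"
  shows "real (\<Sum>s = 1..length I. migration_cost A I s) / real (length I)
    \<le> amortized_migration_factor A I"
  unfolding amortized_migration_factor_def using assms
  by (intro Max_ge) (auto simp: migration_potential_def Suc_le_eq intro!: image_eqI[of _ _ "length I"])

lemma walk_instance_factor:
  fixes \<epsilon> :: real and n :: nat
  defines "I \<equiv> walk_instance (Suc n) (2 * n + 1) (2 * n + 1 + 4 * n)"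
  assumes "maintains_approximation \<epsilon> A I" "0 < \<epsilon>" "\<epsilon> * real (n + 2) < 1"
  shows "real n / 6 \<le> amortized_migration_factor A I"
proof -
  have len: "length I = 2 * n + 1 + 4 * n"
    by (simp add: I_def walk_instance_simps)
  then have "I \<noteq> []"
    by auto
  \<comment> \<open>The instance has 6 n + 1 \<le> 6 (n + 1) steps.\<close>
  have "real n / 6 \<le> real (n * (n + 1)) / real (length I)"
    unfolding len by (simp add: field_simps)
  also have "\<dots> \<le> real (\<Sum>s = 1..length I. migration_cost A I s) / real (length I)"
    unfolding len using walk_instance_migration[OF assms(2-)[unfolded I_def]]
    unfolding I_def by (intro divide_right_mono of_nat_mono) auto
  also have "\<dots> \<le> amortized_migration_factor A I"
    by (rule amortized_migration_factor_ge) fact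
  finally show ?thesis .
qed

theorem theorem20:
  shows "\<exists>c::real. c > 0 \<and> (\<exists>\<epsilon>\<^sub>0::real. \<epsilon>\<^sub>0 > 0 \<and>
           (\<forall>\<epsilon>. 0 < \<epsilon> \<and> \<epsilon> < \<epsilon>\<^sub>0 \<longrightarrow>
             (\<exists>I :: nat event list. valid_instance I \<and>
               (\<forall>A. maintains_approximation \<epsilon> A I \<longrightarrow>
                  amortized_migration_factor A I \<ge> c / \<epsilon>))))"
proof (intro exI conjI allI impI)
  \<comment> \<open>For \<epsilon> < 1/4 the choice of \<open>n\<close> below gives \<epsilon> (n +
    2) \<le> 1/2 + 2 \<epsilon> < 1 and n > 1/(2 \<epsilon>) - 1 > 1/(4 \<epsilon>); dividing by 6
    yields the constant 1/24.\<close>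
  show "0 < (1 / 24 :: real)" "0 < (1 / 4 :: real)"
    by simp_all
  fix \<epsilon> :: real
  assume eps: "0 < \<epsilon> \<and> \<epsilon> < 1 / 4"
  define n where "n = nat \<lfloor>1 / (2 * \<epsilon>)\<rfloor>"
  have n: "real n \<le> 1 / (2 * \<epsilon>)" "1 / (2 * \<epsilon>) < real n + 1"
    using eps by (auto simp: n_def)
  let ?I = "walk_instance (Suc n) (2 * n + 1) (2 * n + 1 + 4 * n)"
  show "valid_instance ?I"
    by (rule valid_walk_instance) simp_all
  have small: "\<epsilon> * real (n + 2) < 1"
    using n(1) eps by (simp add: field_simps)
  have "1 / 24 / \<epsilon> \<le> real n / 6"
    using n(2) eps by (simp add: field_simps)
  then show "1 / 24 / \<epsilon> \<le> amortized_migration_factor A ?I"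
    if "maintains_approximation \<epsilon> A ?I" for A
    using walk_instance_factor[OF that _ small] eps by linarith
qed

end
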